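(* Let $C=(C_1,\ldots,C_m)$ be an equitable partition of the $n$-cube $H^n$ with quotient matrix $S$. Then for all integers $r_1,r_2,r_3$ the vectors $W^{r_1,r_2,r_3}$ satisfy \begin{align*} W^{r_1,r_2,r_3} S''' &= (r_1+1)W^{r_1+1,r_2-1,r_3} + (r_2+1)W^{r_1-1,r_2+1,r_3} + (n-r_1-r_2-r_3+1)W^{r_1,r_2,r_3-1} + (r_3+1)W^{r_1,r_2,r_3+1},\\ W^{r_1,r_2,r_3} S'' &= (r_1+1)W^{r_1+1,r_2,r_3-1} + (r_3+1)W^{r_1-1,r_2,r_3+1} + (n-r_1-r_2-r_3+1)W^{r_1,r_2-1,r_3} + (r_2+1)W^{r_1,r_2+1,r_3},\\ W^{r_1,r_2,r_3} S'^{\mathrm T} &= (r_2+1)W^{r_1,r_2+1,r_3-1} + (r_3+1)W^{r_1,r_2-1,r_3+1} + (n-r_1-r_2-r_3+1)W^{r_1-1,r_2,r_3} + (r_1+1)W^{r_1+1,r_2,r_3}, \end{align*} and the vectors $T^{r_1,r_2,r_3}$ satisfy \begin{align*} T^{r_1,r_2,r_3} S''' &= (r_1+1)T^{r_1+1,r_2-1,r_3} + (r_2+1)T^{r_1-1,r_2+1,r_3} + (n-r_1-r_2-r_3+1)T^{r_1,r_2,r_3-1} + (r_3+1)T^{r_1,r_2,r_3+1},\\ T^{r_1,r_2,r_3} S'' &= (r_1+1)T^{r_1+1,r_2,r_3-1} + (r_3+1)T^{r_1-1,r_2,r_3+1} + (n-r_1-r_2-r_3+1)T^{r_1,r_2-1,r_3}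 + (r_2+1)T^{r_1,r_2+1,r_3},\\ T^{r_1,r_2,r_3} S' &= (r_2+1)T^{r_1,r_2+1,r_3-1} + (r_3+1)T^{r_1,r_2-1,r_3+1} + (n-r_1-r_2-r_3+1)T^{r_1-1,r_2,r_3} + (r_1+1)T^{r_1+1,r_2,r_3}. \end{align*}
   Context: The $n$-cube $H^n$ is the graph whose vertices are the binary words of length $n$, two words adjacent iff they differ in exactly one position; $d$ is the graph (Hamming) distance. An equitable partition of a graph is an ordered partition $C=(C_1,\dots,C_m)$ of its vertex set such that for all $i,j$ every vertex of $C_i$ has the same number $S_{ij}$ of neighbours in $C_j$; $S=(S_{ij})$ is the quotient matrix. For integers $r_1,r_2,r_3$, $T^{r_1,r_2,r_3}_{ijk}$ is the number of triples of vertices $(v,x,y)$ with $v\in C_i$, $x\in C_j$, $y\in C_k$, $d(x,y)=r_2+r_3$, $d(v,y)=r_1+r_3$, $d(v,x)=r_1+r_2$ (so it is $0$ if some $r_\ell<0$ or $r_1+r_2+r_3>n$). For a vertex $v\in C_i$, let $W^{r_1,r_2,r_3}_{ijk}$ be the number of pairs $(x,y)$ with $x\in C_j$, $y\in C_k$ and the same three distance conditions; it is known (strong distance invariance of equitable partitions of $H^n$) that this number does not depend on the choice of $v\in C_i$, so $W^{r_1,r_2,r_3}_{ijk}=T^{r_1,r_2,r_3}_{ijk}/|C_i|$. $W^{r_1,r_2,r_3}$ and $T^{r_1,r_2,r_3}$ are regarded as row vectors of length $m^3$ indexed by $(i,j,k)$. The $m^3\times m^3$ matrices $S',S'',S'''$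 act by $(US')_{ijk}=\sum_{t=1}^m U_{tjk}S_{ti}$, $(US'')_{ijk}=\sum_t U_{itk}S_{tj}$, $(US''')_{ijk}=\sum_t U_{ijt}S_{tk}$ (i.e. $S'=S\otimes I\otimes I$, $S''=I\otimes S\otimes I$, $S'''=I\otimes I\otimes S$), and $S'^{\mathrm T}$ is the transpose of $S'$, i.e. $(US'^{\mathrm T})_{ijk}=\sum_t U_{tjk}S_{it}$. *)

theory Defs
  imports "HOL-Analysis.Analysis"
begin

definition cube :: "nat \<Rightarrow> bool list set" where
  "cube n = {w. length w = n}"

definition hamming :: "bool list \<Rightarrow> bool list \<Rightarrow> nat" where
  "hamming x y = card {p. p < length x \<and> x ! p \<noteq> y ! p}"

definition cube_adj :: "bool list \<Rightarrow> bool list \<Rightarrow> bool" where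
  "cube_adj x y \<longleftrightarrow> hamming x y = 1"

text \<open>An ordered partition into \<open>m\<close> cells is an injective family of cells indexed by a
  finite type \<open>'m\<close> with \<open>m = CARD('m)\<close>; \<open>partition_on\<close> makes the cells nonempty.\<close>

definition equitable_partition ::
  "'v set \<Rightarrow> ('v \<Rightarrow> 'v \<Rightarrow> bool) \<Rightarrow> ('m::finite \<Rightarrow> 'v set) \<Rightarrow> int^'m^'m \<Rightarrow> bool" where
  "equitable_partition V adj C S \<longleftrightarrow>
     inj C \<and> partition_on V (range C) \<and>
     (\<forall>i j. \<forall>v\<in>C i. int (card {u \<in> C j. adj v u}) = S $ i $ j)"

definition dist_cond ::
  "int \<Rightarrow> int \<Rightarrow> int \<Rightarrow> bool list \<Rightarrow> bool list \<Rightarrow> bool list \<Rightarrow> bool" where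
  "dist_cond r1 r2 r3 v x y \<longleftrightarrow>
     int (hamming x y) = r2 + r3 \<and> int (hamming v y) = r1 + r3 \<and> int (hamming v x) = r1 + r2"

definition T_vec ::
  "('m::finite \<Rightarrow> bool list set) \<Rightarrow> int \<Rightarrow> int \<Rightarrow> int \<Rightarrow> int^('m \<times> 'm \<times> 'm)" where
  "T_vec C r1 r2 r3 = (\<chi> p. case p of (i, j, k) \<Rightarrow>
     int (card {(v, x, y). v \<in> C i \<and> x \<in> C j \<and> y \<in> C k \<and> dist_cond r1 r2 r3 v x y}))"

definition pair_count ::
  "('m::finite \<Rightarrow> bool list set) \<Rightarrow> int \<Rightarrow> int \<Rightarrow> int \<Rightarrow> bool list \<Rightarrow> 'm \<Rightarrow> 'm \<Rightarrow> nat" where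
  "pair_count C r1 r2 r3 v j k =
     card {(x, y). x \<in> C j \<and> y \<in> C k \<and> dist_cond r1 r2 r3 v x y}"

text \<open>For an equitable partition of the cube, the count does not depend on the vertex chosen
  from \<open>C i\<close> (strong distance invariance).\<close>

definition W_vec ::
  "('m::finite \<Rightarrow> bool list set) \<Rightarrow> int \<Rightarrow> int \<Rightarrow> int \<Rightarrow> int^('m \<times> 'm \<times> 'm)" where
  "W_vec C r1 r2 r3 = (\<chi> p. case p of (i, j, k) \<Rightarrow> int (pair_count C r1 r2 r3 (SOME v. v \<in> C i) j k))"

definition kron :: "int^'b^'a \<Rightarrow> int^'d^'c \<Rightarrow> int^('b \<times> 'd)^('a \<times> 'c)"
    (infixr \<open>\<otimes>\<^sub>K\<close> 75) where
  "A \<otimes>\<^sub>K B = (\<chi> p q. A $ fst p $ fst q * B $ snd p $ snd q)"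

definition S1 :: "int^'m^'m \<Rightarrow> int^('m \<times> 'm \<times> 'm)^('m \<times> 'm \<times> 'm)" where
  "S1 S = S \<otimes>\<^sub>K mat 1 \<otimes>\<^sub>K mat 1"

definition S2 :: "int^'m^'m \<Rightarrow> int^('m \<times> 'm \<times> 'm)^('m \<times> 'm \<times> 'm)" where
  "S2 S = mat 1 \<otimes>\<^sub>K S \<otimes>\<^sub>K mat 1"

definition S3 :: "int^'m^'m \<Rightarrow> int^('m \<times> 'm \<times> 'm)^('m \<times> 'm \<times> 'm)" where
  "S3 S = mat 1 \<otimes>\<^sub>K mat 1 \<otimes>\<^sub>K S"

lemma sum_triple:
  "sum f (UNIV :: ('m::finite \<times> 'm \<times> 'm) set)
     = (\<Sum>a\<in>UNIV. \<Sum>b\<in>UNIV. \<Sum>c\<in>UNIV. f (a, b, c))"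
proof -
  have "sum f (UNIV :: ('m \<times> 'm \<times> 'm) set)
      = sum f ((UNIV :: 'm set) \<times> ((UNIV :: 'm set) \<times> (UNIV :: 'm set)))"
    by simp
  also have "\<dots> = (\<Sum>a\<in>UNIV. \<Sum>b\<in>UNIV. \<Sum>c\<in>UNIV. f (a, b, c))"
    by (simp only: sum.cartesian_product')
  finally show ?thesis .
qed

lemma sum_mult_delta:
  fixes f :: "'m::finite \<Rightarrow> int"
  shows "(\<Sum>t\<in>UNIV. f t * (if t = a then 1 else 0)) = f a"
    and "(\<Sum>t\<in>UNIV. f t * (if a = t then 1 else 0)) = f a"
  by (simp_all add: if_distrib[of "(*) _"] cong: if_cong)

lemma S1_action: "(U v* S1 S) $ (i, j, k) = (\<Sum>t\<in>UNIV. U $ (t, j, k) * S $ t $ i)"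
  by (simp add: vector_matrix_mult_def S1_def kron_def mat_def sum_triple
      sum_mult_delta mult.assoc[symmetric])

lemma S2_action: "(U v* S2 S) $ (i, j, k) = (\<Sum>t\<in>UNIV. U $ (i, t, k) * S $ t $ j)"
proof -
  have "(U v* S2 S) $ (i, j, k)
      = (\<Sum>a\<in>UNIV. (\<Sum>t\<in>UNIV. U $ (a, t, k) * S $ t $ j) * (if a = i then 1 else 0))"
    unfolding vector_matrix_mult_def S2_def kron_def mat_def
    by (simp add: sum_triple) (intro sum.cong refl, simp add: sum_mult_delta mult.assoc[symmetric])
  then show ?thesis by (simp only: sum_mult_delta)
qed

lemma S3_action: "(U v* S3 S) $ (i, j, k) = (\<Sum>t\<in>UNIV. U $ (i, j, t) * S $ t $ k)"
proof -
  have "(U v* S3 S) $ (i, j, k)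
      = (\<Sum>a\<in>UNIV. (\<Sum>b\<in>UNIV. (\<Sum>t\<in>UNIV. U $ (a, b, t) * S $ t $ k)
          * (if b = j then 1 else 0)) * (if a = i then 1 else 0))"
    unfolding vector_matrix_mult_def S3_def kron_def mat_def
    by (simp only: sum_triple sum_distrib_right) (simp add: mult_ac)
  then show ?thesis by (simp only: sum_mult_delta)
qed

lemma S1_transpose_action:
  "(U v* transpose (S1 S)) $ (i, j, k) = (\<Sum>t\<in>UNIV. U $ (t, j, k) * S $ i $ t)"
  by (simp add: vector_matrix_mult_def S1_def kron_def mat_def transpose_def sum_triple
      sum_mult_delta mult.assoc[symmetric])

end

theory Submission
  imports Defs
begin

text \<open>For words \<open>v, x, y\<close>, each position is of one of four kinds: all three agree there, or
  exactly one of \<open>v\<close>, \<open>x\<close>, \<open>y\<close> differs from the other two. The distance conditions say that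
  the last three kinds occur \<open>r\<^sub>1\<close>, \<open>r\<^sub>2\<close>, \<open>r\<^sub>3\<close> times. Flipping a letter of \<open>y\<close> changes the
  kind of a single position, and counting the flips by kind gives the four coefficients of the
  recurrence. Multiplication by \<open>S\<close> on the last index sums over the neighbours of \<open>y\<close>, because
  the partition is equitable; the other equations follow by permuting \<open>v, x, y\<close>. The equation for
  \<open>W\<close> and the transpose of \<open>S'\<close> moves the base vertex \<open>v\<close>, so it needs strong distance
  invariance, which follows from the recurrence by induction on \<open>r\<^sub>1 + r\<^sub>2 + r\<^sub>3\<close>.\<close>

section \<open>Flipping a letter\<close>

definition flip :: "bool list \<Rightarrow> nat \<Rightarrow> bool list" where
  "flip w p = w[p := \<not> w ! p]"

lemma length_flip [simp]: "length (flip w p) = length w"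
  by (simp add: flip_def)

lemma nth_flip: "p < length w \<Longrightarrow> flip w p ! q = (if q = p then \<not> w ! q else w ! q)"
  by (cases "q = p") (auto simp: flip_def)

lemma finite_cube: "finite (cube n)"
  using finite_lists_length_eq[of "UNIV :: bool set" n] by (simp add: cube_def)

lemma hamming_commute: "length x = length y \<Longrightarrow> hamming x y = hamming y x"
  unfolding hamming_def by metis

lemma hamming_eq_0_iff: "length x = length y \<Longrightarrow> hamming x y = 0 \<longleftrightarrow> x = y"
  unfolding hamming_def by (auto simp: list_eq_iff_nth_eq)

lemma hamming_sum: "int (hamming x y) = (\<Sum>p<length x. of_bool (x ! p \<noteq> y ! p))"
proof -
  have "{p. p < length x \<and> x ! p \<noteq> y ! p} = {..<length x} \<inter> {p. x ! p \<noteq> y ! p}" by auto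
  then show ?thesis by (simp add: hamming_def)
qed

lemma hamming_flip:
  assumes "p < length y" and "length x = length y"
  shows "int (hamming x (flip y p)) = int (hamming x y) + (if x ! p = y ! p then 1 else -1)"
proof -
  have p: "p \<in> {..<length x}" using assms by simp
  have "(\<Sum>q\<in>{..<length x} - {p}. of_bool (x ! q \<noteq> flip y p ! q) :: int)
      = (\<Sum>q\<in>{..<length x} - {p}. of_bool (x ! q \<noteq> y ! q))"
    using assms by (intro sum.cong) (auto simp: nth_flip)
  then show ?thesis
    using assms unfolding hamming_sum sum.remove[OF finite_lessThan p]
    by (auto simp: nth_flip)
qed

lemma cube_adj_iff_flip:
  assumes "length u = length w"
  shows "cube_adj w u \<longleftrightarrow> (\<exists>p<length w. u = flip w p)"
proof
  assume "cube_adj w u"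
  then obtain p where "{p. p < length w \<and> w ! p \<noteq> u ! p} = {p}"
    by (auto simp: cube_adj_def hamming_def card_1_singleton_iff)
  then have "p < length w" "\<And>q. q < length w \<Longrightarrow> w ! q \<noteq> u ! q \<longleftrightarrow> q = p" by auto
  then have "u = flip w p" using assms by (intro nth_equalityI) (auto simp: nth_flip)
  with \<open>p < length w\<close> show "\<exists>p<length w. u = flip w p" by blast
next
  assume "\<exists>p<length w. u = flip w p"
  then obtain p where "p < length w" "u = flip w p" by blast
  then have "{q. q < length w \<and> w ! q \<noteq> u ! q} = {p}" by (auto simp: nth_flip)
  then show "cube_adj w u" by (simp add: cube_adj_def hamming_def)
qed

text \<open>A vertex has exactly one neighbour per position, so a sum over neighbours becomes a sum
  over positions.\<close>

lemma sum_neighbours: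
  assumes "w \<in> cube n"
  shows "(\<Sum>u | u \<in> cube n \<and> cube_adj w u. g u) = (\<Sum>p<n. g (flip w p))"
proof -
  have "inj_on (flip w) {..<n}"
  proof (rule inj_onI)
    fix p q assume *: "p \<in> {..<n}" "q \<in> {..<n}" "flip w p = flip w q"
    then have "p < length w" "q < length w" using assms by (auto simp: cube_def)
    \<comment> \<open>Reading both flipped words at position \<open>p\<close> detects whether
      \<open>q\<close> is the same position.\<close>
    then have "flip w p ! p \<longleftrightarrow> \<not> w ! p" "flip w q ! p \<longleftrightarrow> (if p = q then \<not> w ! p else w ! p)"
      by (simp_all add: nth_flip)
    with *(3) show "p = q" by (auto split: if_splits)
  qed
  moreover have "{u. u \<in> cube n \<and> cube_adj w u} = flip w ` {..<n}"
    using assms by (auto simp: cube_def cube_adj_iff_flip)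
  ultimately show ?thesis by (simp add: sum.reindex)
qed

section \<open>Triples of words\<close>

text \<open>Counts the positions at which the first word is the odd one out. The values are integers
  because they are compared with the integer indices \<open>r1\<close>, \<open>r2\<close>,
  \<open>r3\<close>.\<close>

definition lone :: "bool list \<Rightarrow> bool list \<Rightarrow> bool list \<Rightarrow> int" where
  "lone v x y = (\<Sum>p<length v. of_bool (x ! p = y ! p \<and> v ! p \<noteq> x ! p))"

lemma lone_commute: "lone v x y = lone v y x"
  unfolding lone_def by (intro sum.cong refl arg_cong[of _ _ of_bool]) metis

text \<open>Over a two-letter alphabet, where \<open>x\<close> and \<open>y\<close> differ,
  \<open>v\<close> agrees with exactly one of them and the other one is alone.\<close>

lemma hamming_eq_lone:
  assumes "length x = length y"
  shows "int (hamming x y) = lone x v y + lone y v x"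
proof -
  have "of_bool (a \<noteq> b) = of_bool (c = b \<and> a \<noteq> c) + (of_bool (c = a \<and> b \<noteq> c) :: int)"
    for a b c :: bool
    by (cases a; cases b; cases c) simp_all
  then show ?thesis
    unfolding hamming_sum lone_def assms sum.distrib[symmetric] by (intro sum.cong refl)
qed

text \<open>The three distances are the pairwise sums of the three \<open>lone\<close> counts, and
  pairwise sums determine their summands.\<close>

lemma dist_cond_iff_lone:
  assumes "length v = n" "length x = n" "length y = n"
  shows "dist_cond r1 r2 r3 v x y \<longleftrightarrow> r1 = lone v x y \<and> r2 = lone x v y \<and> r3 = lone y v x"
  using hamming_eq_lone[of x y v] hamming_eq_lone[of v y x] hamming_eq_lone[of v x y] assms
  by (auto simp: dist_cond_def lone_commute[of v y x] lone_commute[of x y v] lone_commute[of y x v])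

lemma lone_nonneg: "0 \<le> lone v x y"
  by (simp add: lone_def sum_nonneg)

text \<open>The indices \<open>r1\<close>, \<open>r2\<close>, \<open>r3\<close> belong to
  \<open>v\<close>, \<open>x\<close>, \<open>y\<close> in this order, so permuting the words
  permutes the indices alike.\<close>

lemma dist_cond_swap_xy:
  assumes "length x = length y"
  shows "dist_cond r1 r2 r3 v x y \<longleftrightarrow> dist_cond r1 r3 r2 v y x"
  unfolding dist_cond_def hamming_commute[OF assms] by (metis add.commute)

lemma dist_cond_swap_vy:
  assumes "length v = n" "length x = n" "length y = n"
  shows "dist_cond r1 r2 r3 v x y \<longleftrightarrow> dist_cond r3 r2 r1 y x v"
  unfolding dist_cond_iff_lone[OF assms] dist_cond_iff_lone[OF assms(3,2,1)]
  using lone_commute by metis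

text \<open>The indices on the right describe the triple before the flip. Where all agree, the flip
  makes \<open>y\<close> alone; where \<open>y\<close> was alone, it makes all agree; otherwise it
  exchanges the roles of \<open>v\<close> and \<open>x\<close> as the odd one.\<close>

lemma dist_cond_flip:
  assumes "length v = n" "length x = n" "length y = n" "p < n"
  shows "dist_cond r1 r2 r3 v x (flip y p) \<longleftrightarrow>
    (if x ! p = y ! p
     then if v ! p = y ! p then dist_cond r1 r2 (r3 - 1) v x y
          else dist_cond (r1 + 1) (r2 - 1) r3 v x y
     else if v ! p = y ! p then dist_cond (r1 - 1) (r2 + 1) r3 v x y
          else dist_cond r1 r2 (r3 + 1) v x y)"
  using assms by (auto simp: dist_cond_def hamming_flip)

lemma sum_dist_cond_flip:
  assumes "v \<in> cube n" "x \<in> cube n" "y \<in> cube n"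
  shows "(\<Sum>p<n. of_bool (dist_cond r1 r2 r3 v x (flip y p)) :: int) =
      (r1 + 1) * of_bool (dist_cond (r1 + 1) (r2 - 1) r3 v x y)
    + (r2 + 1) * of_bool (dist_cond (r1 - 1) (r2 + 1) r3 v x y)
    + (int n - r1 - r2 - r3 + 1) * of_bool (dist_cond r1 r2 (r3 - 1) v x y)
    + (r3 + 1) * of_bool (dist_cond r1 r2 (r3 + 1) v x y)"
proof -
  have len: "length v = n" "length x = n" "length y = n" using assms by (auto simp: cube_def)
  let ?c0 = "of_bool (dist_cond r1 r2 (r3 - 1) v x y) :: int"
  let ?c1 = "of_bool (dist_cond (r1 + 1) (r2 - 1) r3 v x y) :: int"
  let ?c2 = "of_bool (dist_cond (r1 - 1) (r2 + 1) r3 v x y) :: int"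
  let ?c3 = "of_bool (dist_cond r1 r2 (r3 + 1) v x y) :: int"
  \<comment> \<open>The value \<open>?c0\<close> of an all-agreeing position serves as the default,
    and each of the other three kinds enters as a correction to it.\<close>
  have "(\<Sum>p<n. of_bool (dist_cond r1 r2 r3 v x (flip y p)) :: int) =
    (\<Sum>p<n. ?c0 + (?c1 - ?c0) * of_bool (x ! p = y ! p \<and> v ! p \<noteq> x ! p)
      + (?c2 - ?c0) * of_bool (v ! p = y ! p \<and> x ! p \<noteq> v ! p)
      + (?c3 - ?c0) * of_bool (v ! p = x ! p \<and> y ! p \<noteq> v ! p))"
    by (rule sum.cong) (use len in \<open>auto simp: dist_cond_flip\<close>)
  also have "\<dots> = int n * ?c0 + (?c1 - ?c0) * lone v x y
      + (?c2 - ?c0) * lone x v y + (?c3 - ?c0) * lone y v x"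
    by (simp only: sum.distrib sum_distrib_left[symmetric] lone_def len) simp
  also have "\<dots> = int n * ?c0 + (?c1 * (r1 + 1) - ?c0 * r1)
      + (?c2 * (r2 + 1) - ?c0 * r2) + (?c3 * (r3 + 1) - ?c0 * (r3 - 1))"
  proof -
    \<comment> \<open>Each indicator either vanishes or fixes the \<open>lone\<close> counts. Under
      \<open>?c0\<close> the third count is \<open>r3 - 1\<close>, the source of the
      \<open>+ 1\<close> in the coefficient with \<open>n\<close>.\<close>
    have "?c0 * lone v x y = ?c0 * r1" "?c0 * lone x v y = ?c0 * r2"
      "?c0 * lone y v x = ?c0 * (r3 - 1)" "?c1 * lone v x y = ?c1 * (r1 + 1)"
      "?c2 * lone x v y = ?c2 * (r2 + 1)" "?c3 * lone y v x = ?c3 * (r3 + 1)"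
      by (simp_all add: dist_cond_iff_lone[OF len])
    then show ?thesis by (simp only: left_diff_distrib)
  qed
  finally show ?thesis
    by (simp only: algebra_simps)
qed

section \<open>Equitable partitions of the cube\<close>

context
  fixes n :: nat and C :: "'m::finite \<Rightarrow> bool list set" and S :: "int^'m^'m"
  assumes equitable: "equitable_partition (cube n) cube_adj C S"
begin

lemma cell_subset: "C i \<subseteq> cube n"
  using equitable by (auto simp: equitable_partition_def partition_on_def)

lemma finite_cell: "finite (C i)"
  using cell_subset finite_cube finite_subset by blast

lemma cell_unique:
  assumes "v \<in> C i" and "v \<in> C j"
  shows "i = j"
proof -
  have "inj C" and "disjoint (range C)"
    using equitable by (auto simp: equitable_partition_def partition_on_def)
  then have "C i = C j" using disjointD[of "range C" "C i" "C j"] assms by blast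
  with \<open>inj C\<close> show ?thesis by (rule injD)
qed

lemma some_in_cell: "(SOME v. v \<in> C i) \<in> C i"
proof -
  have "C i \<noteq> {}" using equitable by (auto simp: equitable_partition_def partition_on_def)
  then show ?thesis by (simp add: some_in_eq)
qed

lemma sum_cube_cells:
  fixes g :: "bool list \<Rightarrow> int"
  shows "(\<Sum>v\<in>cube n. g v) = (\<Sum>i\<in>UNIV. \<Sum>v\<in>C i. g v)"
proof -
  have "cube n = (\<Union>i. C i)"
    using equitable by (auto simp: equitable_partition_def partition_on_def)
  moreover have "\<forall>i\<in>UNIV. \<forall>j\<in>UNIV. i \<noteq> j \<longrightarrow> C i \<inter> C j = {}"
    using cell_unique by blast
  ultimately show ?thesis
    using sum.UNION_disjoint[of UNIV C g] finite_cell by simp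
qed

lemma quotient_entry:
  assumes "v \<in> C i"
  shows "S $ i $ j = (\<Sum>u\<in>C j. of_bool (cube_adj v u))"
proof -
  have "\<forall>i j. \<forall>v\<in>C i. int (card {u \<in> C j. cube_adj v u}) = S $ i $ j"
    using equitable unfolding equitable_partition_def by blast
  then have "S $ i $ j = int (card {u \<in> C j. cube_adj v u})"
    using assms by simp
  also have "{u \<in> C j. cube_adj v u} = C j \<inter> {u. cube_adj v u}" by blast
  finally show ?thesis by (simp add: finite_cell)
qed

lemma cube_adj_commute: "u \<in> cube n \<Longrightarrow> v \<in> cube n \<Longrightarrow> cube_adj u v \<longleftrightarrow> cube_adj v u"
  by (simp add: cube_adj_def cube_def hamming_commute)

lemma sum_adjacent:
  fixes g :: "bool list \<Rightarrow> int"
  assumes "w \<in> cube n"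
  shows "(\<Sum>u\<in>cube n. g u * of_bool (cube_adj w u)) = (\<Sum>p<n. g (flip w p))"
proof -
  have "(\<Sum>u\<in>cube n. g u * of_bool (cube_adj w u))
      = (\<Sum>u | u \<in> cube n \<and> cube_adj w u. g u)"
    by (rule sum.mono_neutral_cong_right) (auto simp: finite_cube)
  then show ?thesis using sum_neighbours[OF assms] by simp
qed

text \<open>Every \<open>u\<close> in \<open>C t\<close> has \<open>S $ t $ k\<close> neighbours in
  \<open>C k\<close>, so the left side is a sum over edges ending in \<open>C k\<close>. Symmetry of
  adjacency lets it be regrouped by the endpoint \<open>w\<close>.\<close>

lemma sum_cells_times_quotient:
  fixes g :: "bool list \<Rightarrow> int"
  shows "(\<Sum>t\<in>UNIV. (\<Sum>u\<in>C t. g u) * S $ t $ k) = (\<Sum>w\<in>C k. \<Sum>p<n. g (flip w p))"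
proof -
  have "(\<Sum>t\<in>UNIV. (\<Sum>u\<in>C t. g u) * S $ t $ k)
      = (\<Sum>t\<in>UNIV. \<Sum>u\<in>C t. \<Sum>w\<in>C k. g u * of_bool (cube_adj u w))"
    unfolding sum_distrib_right
    by (intro sum.cong refl) (simp only: quotient_entry sum_distrib_left)
  also have "\<dots> = (\<Sum>u\<in>cube n. \<Sum>w\<in>C k. g u * of_bool (cube_adj u w))"
    by (rule sum_cube_cells[symmetric])
  also have "\<dots> = (\<Sum>w\<in>C k. \<Sum>u\<in>cube n. g u * of_bool (cube_adj w u))"
    by (subst sum.swap, intro sum.cong refl)
      (use cell_subset[of k] in \<open>auto simp: cube_adj_commute subset_iff\<close>)
  also have "\<dots> = (\<Sum>w\<in>C k. \<Sum>p<n. g (flip w p))"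
    using cell_subset by (intro sum.cong refl sum_adjacent) auto
  finally show ?thesis .
qed

text \<open>The row counterpart: the neighbours of a single vertex \<open>v\<close> are sorted by
  cell, with \<open>h\<close> constant on each cell.\<close>

lemma sum_quotient_row:
  fixes g :: "'m \<Rightarrow> int" and h :: "bool list \<Rightarrow> int"
  assumes "v \<in> C i" and "\<And>t u. u \<in> C t \<Longrightarrow> h u = g t"
  shows "(\<Sum>t\<in>UNIV. g t * S $ i $ t) = (\<Sum>p<n. h (flip v p))"
proof -
  have "(\<Sum>t\<in>UNIV. g t * S $ i $ t)
      = (\<Sum>t\<in>UNIV. \<Sum>u\<in>C t. h u * of_bool (cube_adj v u))"
    unfolding quotient_entry[OF assms(1)] sum_distrib_left
    by (intro sum.cong refl) (simp add: assms(2))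
  also have "\<dots> = (\<Sum>u\<in>cube n. h u * of_bool (cube_adj v u))"
    by (rule sum_cube_cells[symmetric])
  also have "\<dots> = (\<Sum>p<n. h (flip v p))"
    using assms(1) cell_subset by (intro sum_adjacent) auto
  finally show ?thesis .
qed

section \<open>Counts of pairs and triples, and their symmetries\<close>

lemma pair_count_sum:
  "int (pair_count C r1 r2 r3 v j k)
    = (\<Sum>x\<in>C j. \<Sum>y\<in>C k. of_bool (dist_cond r1 r2 r3 v x y))"
proof -
  have "{(x, y). x \<in> C j \<and> y \<in> C k \<and> dist_cond r1 r2 r3 v x y}
      = (C j \<times> C k) \<inter> {z. dist_cond r1 r2 r3 v (fst z) (snd z)}" by auto
  then have "int (pair_count C r1 r2 r3 v j k)
      = (\<Sum>z\<in>C j \<times> C k. of_bool (dist_cond r1 r2 r3 v (fst z) (snd z)))"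
    by (simp add: pair_count_def finite_cell)
  then show ?thesis by (simp only: sum.cartesian_product' fst_conv snd_conv)
qed

lemma T_vec_sum:
  "T_vec C r1 r2 r3 $ (i, j, k) = (\<Sum>v\<in>C i. int (pair_count C r1 r2 r3 v j k))"
proof -
  have "{(v, x, y). v \<in> C i \<and> x \<in> C j \<and> y \<in> C k \<and> dist_cond r1 r2 r3 v x y}
      = (SIGMA v:C i. {(x, y). x \<in> C j \<and> y \<in> C k \<and> dist_cond r1 r2 r3 v x y})" by auto
  moreover have "finite {(x, y). x \<in> C j \<and> y \<in> C k \<and> dist_cond r1 r2 r3 v x y}" for v
    by (rule finite_subset[of _ "C j \<times> C k"]) (auto simp: finite_cell)
  ultimately show ?thesis
    by (simp add: T_vec_def pair_count_def card_SigmaI finite_cell)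
qed

lemma pair_count_swap:
  "pair_count C r1 r2 r3 v j k = pair_count C r1 r3 r2 v k j"
proof -
  have "int (pair_count C r1 r2 r3 v j k)
      = (\<Sum>x\<in>C j. \<Sum>y\<in>C k. of_bool (dist_cond r1 r3 r2 v y x))"
    unfolding pair_count_sum using cell_subset
    by (intro sum.cong refl arg_cong[of _ _ of_bool] dist_cond_swap_xy) (auto simp: cube_def)
  also have "\<dots> = int (pair_count C r1 r3 r2 v k j)"
    unfolding pair_count_sum by (rule sum.swap)
  finally show ?thesis by simp
qed

lemma T_vec_swap: "T_vec C r1 r2 r3 $ (i, j, k) = T_vec C r3 r2 r1 $ (k, j, i)"
proof -
  have "T_vec C r1 r2 r3 $ (i, j, k)
      = (\<Sum>v\<in>C i. \<Sum>x\<in>C j. \<Sum>y\<in>C k. of_bool (dist_cond r3 r2 r1 y x v))"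
    unfolding T_vec_sum pair_count_sum using cell_subset
    by (intro sum.cong refl arg_cong[of _ _ of_bool] dist_cond_swap_vy[where n = n])
      (auto simp: cube_def)
  also have "\<dots> = (\<Sum>v\<in>C i. \<Sum>y\<in>C k. \<Sum>x\<in>C j. of_bool (dist_cond r3 r2 r1 y x v))"
    by (intro sum.cong refl sum.swap)
  also have "\<dots> = (\<Sum>y\<in>C k. \<Sum>v\<in>C i. \<Sum>x\<in>C j. of_bool (dist_cond r3 r2 r1 y x v))"
    by (rule sum.swap)
  also have "\<dots> = T_vec C r3 r2 r1 $ (k, j, i)"
    unfolding T_vec_sum pair_count_sum by (intro sum.cong refl sum.swap)
  finally show ?thesis .
qed

text \<open>The base vertex \<open>v\<close> stays fixed. This form drives the induction for strong
  distance invariance and, summed over a cell, yields the equations for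
  \<open>T_vec\<close>.\<close>

lemma pair_count_recurrence_y:
  assumes "v \<in> cube n"
  shows "(\<Sum>t\<in>UNIV. int (pair_count C r1 r2 r3 v j t) * S $ t $ k) =
      (r1 + 1) * int (pair_count C (r1 + 1) (r2 - 1) r3 v j k)
    + (r2 + 1) * int (pair_count C (r1 - 1) (r2 + 1) r3 v j k)
    + (int n - r1 - r2 - r3 + 1) * int (pair_count C r1 r2 (r3 - 1) v j k)
    + (r3 + 1) * int (pair_count C r1 r2 (r3 + 1) v j k)"
proof -
  have "(\<Sum>t\<in>UNIV. int (pair_count C r1 r2 r3 v j t) * S $ t $ k)
      = (\<Sum>t\<in>UNIV. (\<Sum>y\<in>C t. \<Sum>x\<in>C j. of_bool (dist_cond r1 r2 r3 v x y)) * S $ t $ k)"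
    unfolding pair_count_sum by (subst sum.swap) (rule refl)
  also have "\<dots> = (\<Sum>y\<in>C k. \<Sum>p<n. \<Sum>x\<in>C j. of_bool (dist_cond r1 r2 r3 v x (flip y p)))"
    by (rule sum_cells_times_quotient)
  also have "\<dots> = (\<Sum>y\<in>C k. \<Sum>x\<in>C j. \<Sum>p<n. of_bool (dist_cond r1 r2 r3 v x (flip y p)))"
    by (intro sum.cong refl sum.swap)
  also have "\<dots> = (\<Sum>x\<in>C j. \<Sum>y\<in>C k. \<Sum>p<n. of_bool (dist_cond r1 r2 r3 v x (flip y p)))"
    by (rule sum.swap)
  also have "\<dots> = (\<Sum>x\<in>C j. \<Sum>y\<in>C k.
      (r1 + 1) * of_bool (dist_cond (r1 + 1) (r2 - 1) r3 v x y)
    + (r2 + 1) * of_bool (dist_cond (r1 - 1) (r2 + 1) r3 v x y)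
    + (int n - r1 - r2 - r3 + 1) * of_bool (dist_cond r1 r2 (r3 - 1) v x y)
    + (r3 + 1) * of_bool (dist_cond r1 r2 (r3 + 1) v x y))"
    using assms cell_subset by (intro sum.cong refl sum_dist_cond_flip) auto
  finally show ?thesis
    unfolding pair_count_sum sum_distrib_left sum.distrib .
qed

lemma pair_count_recurrence_x:
  assumes "v \<in> cube n"
  shows "(\<Sum>t\<in>UNIV. int (pair_count C r1 r2 r3 v t k) * S $ t $ j) =
      (r1 + 1) * int (pair_count C (r1 + 1) r2 (r3 - 1) v j k)
    + (r3 + 1) * int (pair_count C (r1 - 1) r2 (r3 + 1) v j k)
    + (int n - r1 - r2 - r3 + 1) * int (pair_count C r1 (r2 - 1) r3 v j k)
    + (r2 + 1) * int (pair_count C r1 (r2 + 1) r3 v j k)"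
  using pair_count_recurrence_y[OF assms, of r1 r3 r2 k j]
  \<comment> \<open>Fixing the second index in each instance orients the rewriting:
    \<open>r2\<close> and its shifts move to third place and stay there.\<close>
  by (simp only: pair_count_swap[of _ r2] pair_count_swap[of _ "r2 - 1"]
      pair_count_swap[of _ "r2 + 1"] Groups.diff_right_commute[of _ r3 r2])

section \<open>Strong distance invariance\<close>

text \<open>The indices are numbers of positions.\<close>

lemma pair_count_negative:
  assumes "v \<in> cube n" and "r1 < 0 \<or> r2 < 0 \<or> r3 < 0"
  shows "pair_count C r1 r2 r3 v j k = 0"
proof -
  have "\<not> dist_cond r1 r2 r3 v x y" if "x \<in> C j" "y \<in> C k" for x y
  proof -
    have "length v = n" "length x = n" "length y = n"
      using that assms(1) cell_subset by (auto simp: cube_def)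
    then show ?thesis
      using assms(2) lone_nonneg[of v x y] lone_nonneg[of x v y] lone_nonneg[of y v x]
      by (auto simp: dist_cond_iff_lone)
  qed
  then have "{(x, y). x \<in> C j \<and> y \<in> C k \<and> dist_cond r1 r2 r3 v x y} = {}" by auto
  then show ?thesis by (simp only: pair_count_def card.empty)
qed

text \<open>Indices \<open>r 0 0\<close> force \<open>x = y\<close>, while \<open>0 0 r\<close>
  force \<open>x = v\<close>. Both counts thus reduce to the vertices of \<open>C k\<close> at
  distance \<open>r\<close> from \<open>v\<close>.\<close>

lemma pair_count_diagonal:
  assumes "v \<in> C i"
  shows "pair_count C r 0 0 v j k = (if j = k then pair_count C 0 0 r v i k else 0)"
proof -
  have len: "length u = n" if "u \<in> C l" for u l using that cell_subset by (auto simp: cube_def)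
  have eq0: "hamming x y = 0 \<longleftrightarrow> x = y" if "x \<in> C a" "y \<in> C b" for x y a b
    using len[OF that(1)] len[OF that(2)] by (simp add: hamming_eq_0_iff)
  have "{(x, y). x \<in> C j \<and> y \<in> C k \<and> dist_cond r 0 0 v x y}
      = (if j = k then (\<lambda>y. (y, y)) ` {y \<in> C k. int (hamming v y) = r} else {})"
    using eq0 cell_unique by (auto simp: dist_cond_def)
  moreover have "{(x, y). x \<in> C i \<and> y \<in> C k \<and> dist_cond 0 0 r v x y}
      = (\<lambda>y. (v, y)) ` {y \<in> C k. int (hamming v y) = r}"
    using eq0 assms by (auto simp: dist_cond_def)
  ultimately show ?thesis
    by (auto simp: pair_count_def card_image inj_on_def)
qed

lemma pair_count_0:
  assumes "v \<in> C i"
  shows "pair_count C 0 0 0 v j k = of_bool (j = i \<and> k = i)"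
proof -
  have len: "length u = n" if "u \<in> C l" for u l using that cell_subset by (auto simp: cube_def)
  have eq0: "hamming x y = 0 \<longleftrightarrow> x = y" if "x \<in> C a" "y \<in> C b" for x y a b
    using len[OF that(1)] len[OF that(2)] by (simp add: hamming_eq_0_iff)
  have "{(x, y). x \<in> C j \<and> y \<in> C k \<and> dist_cond 0 0 0 v x y}
      = (if j = i \<and> k = i then {(v, v)} else {})"
    using assms eq0 cell_unique by (auto simp: dist_cond_def)
  then show ?thesis by (simp add: pair_count_def)
qed

text \<open>The recurrence expresses the vector at \<open>(r\<^sub>1, r\<^sub>2, r\<^sub>3)\<close> by vectors with smaller index sum
  when \<open>r\<^sub>3 > 0\<close>, and symmetrically when \<open>r\<^sub>2 > 0\<close>. What remains is \<open>(r, 0, 0)\<close>, where \<open>x = y\<close>;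
  it carries the same information as \<open>(0, 0, r)\<close>.\<close>

lemma pair_count_invariant:
  assumes "v \<in> C i" and "v' \<in> C i"
  shows "pair_count C r1 r2 r3 v j k = pair_count C r1 r2 r3 v' j k"
proof -
  have cube: "v \<in> cube n" "v' \<in> cube n" using assms cell_subset by auto
  \<comment> \<open>The indices and both cells stay general, since the recurrence shifts the former
    and sums over cells, and the diagonal case replaces \<open>j\<close> by
    \<open>i\<close>.\<close>
  have "\<forall>r1 r2 r3 j k. r1 + r2 + r3 < int N \<longrightarrow>
      pair_count C r1 r2 r3 v j k = pair_count C r1 r2 r3 v' j k" for N
  proof (induction N)
    case 0
    show ?case
    proof (intro allI impI)
      fix r1 r2 r3 :: int and j k
      assume "r1 + r2 + r3 < int 0"
      then have "r1 < 0 \<or> r2 < 0 \<or> r3 < 0" by auto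
      then show "pair_count C r1 r2 r3 v j k = pair_count C r1 r2 r3 v' j k"
        using pair_count_negative cube by simp
    qed
  next
    case (Suc N)
    have IH: "pair_count C s1 s2 s3 v a b = pair_count C s1 s2 s3 v' a b"
      if "s1 + s2 + s3 < int N" for s1 s2 s3 a b
      using Suc that by blast
    have r3_pos: "pair_count C r1 r2 r3 v j k = pair_count C r1 r2 r3 v' j k"
      if "r1 + r2 + r3 < int (Suc N)" "r3 > 0" for r1 r2 r3 j k
    proof -
      \<comment> \<open>In the recurrence at \<open>r3 - 1\<close> only the last term, with
        coefficient \<open>r3\<close>, has the full index sum; all others fall under
        \<open>IH\<close>.\<close>
      have "r3 * int (pair_count C r1 r2 r3 v j k) = r3 * int (pair_count C r1 r2 r3 v' j k)"
        using pair_count_recurrence_y[OF cube(1), of r1 r2 "r3 - 1" j k]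
          pair_count_recurrence_y[OF cube(2), of r1 r2 "r3 - 1" j k] that
        by (simp add: IH)
      then show ?thesis using that by simp
    qed
    show ?case
    proof (intro allI impI)
      fix r1 r2 r3 :: int and j k
      assume less: "r1 + r2 + r3 < int (Suc N)"
      consider "r1 < 0 \<or> r2 < 0 \<or> r3 < 0" | "r3 > 0" | "r2 > 0"
        | "r2 = 0" "r3 = 0" "r1 > 0" | "r1 = 0" "r2 = 0" "r3 = 0" by linarith
      then show "pair_count C r1 r2 r3 v j k = pair_count C r1 r2 r3 v' j k"
      proof cases
        case 1
        then show ?thesis using pair_count_negative cube by simp
      next
        case 2
        then show ?thesis using r3_pos less by blast
      next
        case 3
        then have "pair_count C r1 r3 r2 v k j = pair_count C r1 r3 r2 v' k j"
          using less by (intro r3_pos) auto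
        then show ?thesis by (simp only: pair_count_swap[of r1 r2 r3])
      next
        case 4
        then have "pair_count C 0 0 r1 v i k = pair_count C 0 0 r1 v' i k"
          using less by (intro r3_pos) auto
        then show ?thesis using 4 by (simp add: pair_count_diagonal[OF assms(1)]
              pair_count_diagonal[OF assms(2)])
      next
        case 5
        then show ?thesis by (simp add: pair_count_0[OF assms(1)] pair_count_0[OF assms(2)])
      qed
    qed
  qed
  \<comment> \<open>Truncation by \<open>nat\<close> is harmless: a negative index sum gives the
    bound \<open>0\<close>, which still exceeds it.\<close>
  from this[of "nat (r1 + r2 + r3 + 1)"] show ?thesis by simp
qed

section \<open>Recurrences for \<open>W_vec\<close> and \<open>T_vec\<close>\<close>

lemma W_vec_eq_pair_count:
  assumes "v \<in> C i"
  shows "W_vec C r1 r2 r3 $ (i, j, k) = int (pair_count C r1 r2 r3 v j k)"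
  using pair_count_invariant[OF some_in_cell assms] by (simp add: W_vec_def)

lemma W_vec_recurrence_y:
  "(\<Sum>t\<in>UNIV. W_vec C r1 r2 r3 $ (i, j, t) * S $ t $ k) =
      (r1 + 1) * W_vec C (r1 + 1) (r2 - 1) r3 $ (i, j, k)
    + (r2 + 1) * W_vec C (r1 - 1) (r2 + 1) r3 $ (i, j, k)
    + (int n - r1 - r2 - r3 + 1) * W_vec C r1 r2 (r3 - 1) $ (i, j, k)
    + (r3 + 1) * W_vec C r1 r2 (r3 + 1) $ (i, j, k)"
  unfolding W_vec_eq_pair_count[OF some_in_cell]
  using some_in_cell cell_subset by (intro pair_count_recurrence_y) blast

lemma W_vec_recurrence_x:
  "(\<Sum>t\<in>UNIV. W_vec C r1 r2 r3 $ (i, t, k) * S $ t $ j) =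
      (r1 + 1) * W_vec C (r1 + 1) r2 (r3 - 1) $ (i, j, k)
    + (r3 + 1) * W_vec C (r1 - 1) r2 (r3 + 1) $ (i, j, k)
    + (int n - r1 - r2 - r3 + 1) * W_vec C r1 (r2 - 1) r3 $ (i, j, k)
    + (r2 + 1) * W_vec C r1 (r2 + 1) r3 $ (i, j, k)"
  unfolding W_vec_eq_pair_count[OF some_in_cell]
  using some_in_cell cell_subset by (intro pair_count_recurrence_x) blast

text \<open>By invariance the entry at cell \<open>t\<close> is the pair count at any neighbour of
  \<open>v\<close> in \<open>C t\<close>. There are \<open>S $ i $ t\<close> such neighbours, which
  is why a row of \<open>S\<close>, hence a transpose, appears.\<close>

lemma W_vec_recurrence_v:
  "(\<Sum>t\<in>UNIV. W_vec C r1 r2 r3 $ (t, j, k) * S $ i $ t) =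
      (r2 + 1) * W_vec C r1 (r2 + 1) (r3 - 1) $ (i, j, k)
    + (r3 + 1) * W_vec C r1 (r2 - 1) (r3 + 1) $ (i, j, k)
    + (int n - r1 - r2 - r3 + 1) * W_vec C (r1 - 1) r2 r3 $ (i, j, k)
    + (r1 + 1) * W_vec C (r1 + 1) r2 r3 $ (i, j, k)"
proof -
  define v where "v = (SOME v. v \<in> C i)"
  have v: "v \<in> C i" unfolding v_def by (rule some_in_cell)
  then have vn: "v \<in> cube n" using cell_subset by auto
  have swap: "dist_cond s1 s2 s3 w x y \<longleftrightarrow> dist_cond s3 s2 s1 y x w"
    if "w \<in> cube n" "x \<in> C j" "y \<in> C k" for s1 s2 s3 w x y
    using that cell_subset by (intro dist_cond_swap_vy[where n = n]) (auto simp: cube_def)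
  have flip: "flip v p \<in> cube n" for p using vn by (simp add: cube_def)
  have "(\<Sum>t\<in>UNIV. W_vec C r1 r2 r3 $ (t, j, k) * S $ i $ t)
      = (\<Sum>p<n. \<Sum>x\<in>C j. \<Sum>y\<in>C k. of_bool (dist_cond r1 r2 r3 (flip v p) x y))"
    using W_vec_eq_pair_count pair_count_sum by (intro sum_quotient_row[OF v]) metis
  also have "\<dots> = (\<Sum>x\<in>C j. \<Sum>p<n. \<Sum>y\<in>C k. of_bool (dist_cond r1 r2 r3 (flip v p) x y))"
    by (rule sum.swap)
  also have "\<dots> = (\<Sum>x\<in>C j. \<Sum>y\<in>C k. \<Sum>p<n. of_bool (dist_cond r1 r2 r3 (flip v p) x y))"
    by (intro sum.cong refl sum.swap)
  \<comment> \<open>Reversing the triple puts the flipped word last, where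
    \<open>sum_dist_cond_flip\<close> applies.\<close>
  also have "\<dots> = (\<Sum>x\<in>C j. \<Sum>y\<in>C k. \<Sum>p<n. of_bool (dist_cond r3 r2 r1 y x (flip v p)))"
    using flip by (intro sum.cong refl arg_cong[of _ _ of_bool] swap) auto
  also have "\<dots> = (\<Sum>x\<in>C j. \<Sum>y\<in>C k.
      (r3 + 1) * of_bool (dist_cond (r3 + 1) (r2 - 1) r1 y x v)
    + (r2 + 1) * of_bool (dist_cond (r3 - 1) (r2 + 1) r1 y x v)
    + (int n - r3 - r2 - r1 + 1) * of_bool (dist_cond r3 r2 (r1 - 1) y x v)
    + (r1 + 1) * of_bool (dist_cond r3 r2 (r1 + 1) y x v))"
    using vn cell_subset by (intro sum.cong refl sum_dist_cond_flip) auto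
  also have "\<dots> = (\<Sum>x\<in>C j. \<Sum>y\<in>C k.
      (r2 + 1) * of_bool (dist_cond r1 (r2 + 1) (r3 - 1) v x y)
    + (r3 + 1) * of_bool (dist_cond r1 (r2 - 1) (r3 + 1) v x y)
    + (int n - r1 - r2 - r3 + 1) * of_bool (dist_cond (r1 - 1) r2 r3 v x y)
    + (r1 + 1) * of_bool (dist_cond (r1 + 1) r2 r3 v x y))"
    by (intro sum.cong refl) (simp only: swap[OF vn] algebra_simps)
  finally show ?thesis
    unfolding W_vec_eq_pair_count[OF v] pair_count_sum sum_distrib_left sum.distrib .
qed

text \<open>The recurrence for a fixed vertex is summed over \<open>v\<close> in
  \<open>C i\<close>.\<close>

lemma T_vec_recurrence_y:
  "(\<Sum>t\<in>UNIV. T_vec C r1 r2 r3 $ (i, j, t) * S $ t $ k) =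
      (r1 + 1) * T_vec C (r1 + 1) (r2 - 1) r3 $ (i, j, k)
    + (r2 + 1) * T_vec C (r1 - 1) (r2 + 1) r3 $ (i, j, k)
    + (int n - r1 - r2 - r3 + 1) * T_vec C r1 r2 (r3 - 1) $ (i, j, k)
    + (r3 + 1) * T_vec C r1 r2 (r3 + 1) $ (i, j, k)"
  unfolding T_vec_sum sum_distrib_left sum_distrib_right sum.distrib[symmetric]
  using cell_subset
  by (subst sum.swap) (intro sum.cong refl pair_count_recurrence_y, auto)

lemma T_vec_recurrence_x:
  "(\<Sum>t\<in>UNIV. T_vec C r1 r2 r3 $ (i, t, k) * S $ t $ j) =
      (r1 + 1) * T_vec C (r1 + 1) r2 (r3 - 1) $ (i, j, k)
    + (r3 + 1) * T_vec C (r1 - 1) r2 (r3 + 1) $ (i, j, k)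
    + (int n - r1 - r2 - r3 + 1) * T_vec C r1 (r2 - 1) r3 $ (i, j, k)
    + (r2 + 1) * T_vec C r1 (r2 + 1) r3 $ (i, j, k)"
  unfolding T_vec_sum sum_distrib_left sum_distrib_right sum.distrib[symmetric]
  using cell_subset
  by (subst sum.swap) (intro sum.cong refl pair_count_recurrence_x, auto)

text \<open>Triples have no distinguished base vertex, so reversal turns \<open>v\<close> into the
  last word and a column of \<open>S\<close> appears, in contrast to \<open>W_vec\<close>.\<close>

lemma T_vec_recurrence_v:
  "(\<Sum>t\<in>UNIV. T_vec C r1 r2 r3 $ (t, j, k) * S $ t $ i) =
      (r2 + 1) * T_vec C r1 (r2 + 1) (r3 - 1) $ (i, j, k)
    + (r3 + 1) * T_vec C r1 (r2 - 1) (r3 + 1) $ (i, j, k)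
    + (int n - r1 - r2 - r3 + 1) * T_vec C (r1 - 1) r2 r3 $ (i, j, k)
    + (r1 + 1) * T_vec C (r1 + 1) r2 r3 $ (i, j, k)"
  using T_vec_recurrence_y[of r3 r2 r1 k j i]
  by (simp add: T_vec_swap[of _ _ _ _ j k] algebra_simps)

end

theorem theorem2:
  fixes n :: nat
    and C :: "'m::finite \<Rightarrow> bool list set"
    and S :: "int^'m^'m"
    and r1 r2 r3 :: int
  assumes "equitable_partition (cube n) cube_adj C S"
  shows "W_vec C r1 r2 r3 v* S3 S =
      (r1 + 1) *s W_vec C (r1 + 1) (r2 - 1) r3
      + (r2 + 1) *s W_vec C (r1 - 1) (r2 + 1) r3
      + (int n - r1 - r2 - r3 + 1) *s W_vec C r1 r2 (r3 - 1)
      + (r3 + 1) *s W_vec C r1 r2 (r3 + 1) \<and>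
    W_vec C r1 r2 r3 v* S2 S =
      (r1 + 1) *s W_vec C (r1 + 1) r2 (r3 - 1)
      + (r3 + 1) *s W_vec C (r1 - 1) r2 (r3 + 1)
      + (int n - r1 - r2 - r3 + 1) *s W_vec C r1 (r2 - 1) r3
      + (r2 + 1) *s W_vec C r1 (r2 + 1) r3 \<and>
    W_vec C r1 r2 r3 v* transpose (S1 S) =
      (r2 + 1) *s W_vec C r1 (r2 + 1) (r3 - 1)
      + (r3 + 1) *s W_vec C r1 (r2 - 1) (r3 + 1)
      + (int n - r1 - r2 - r3 + 1) *s W_vec C (r1 - 1) r2 r3
      + (r1 + 1) *s W_vec C (r1 + 1) r2 r3 \<and>
    T_vec C r1 r2 r3 v* S3 S =
      (r1 + 1) *s T_vec C (r1 + 1) (r2 - 1) r3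
      + (r2 + 1) *s T_vec C (r1 - 1) (r2 + 1) r3
      + (int n - r1 - r2 - r3 + 1) *s T_vec C r1 r2 (r3 - 1)
      + (r3 + 1) *s T_vec C r1 r2 (r3 + 1) \<and>
    T_vec C r1 r2 r3 v* S2 S =
      (r1 + 1) *s T_vec C (r1 + 1) r2 (r3 - 1)
      + (r3 + 1) *s T_vec C (r1 - 1) r2 (r3 + 1)
      + (int n - r1 - r2 - r3 + 1) *s T_vec C r1 (r2 - 1) r3
      + (r2 + 1) *s T_vec C r1 (r2 + 1) r3 \<and>
    T_vec C r1 r2 r3 v* S1 S =
      (r2 + 1) *s T_vec C r1 (r2 + 1) (r3 - 1)
      + (r3 + 1) *s T_vec C r1 (r2 - 1) (r3 + 1)
      + (int n - r1 - r2 - r3 + 1) *s T_vec C (r1 - 1) r2 r3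
      + (r1 + 1) *s T_vec C (r1 + 1) r2 r3"
  by (simp only: vec_eq_iff split_paired_All S1_action S2_action S3_action S1_transpose_action
      vector_add_component vector_smult_component
      W_vec_recurrence_v[OF assms] W_vec_recurrence_x[OF assms] W_vec_recurrence_y[OF assms]
      T_vec_recurrence_v[OF assms] T_vec_recurrence_x[OF assms] T_vec_recurrence_y[OF assms]
      simp_thms)

end
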